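(* Let $n,k,l$ be positive integers with $l\le k\le n-1$. Let $E_n(k,l)$ be the expected value of the selected value $s$ when the stopping rule $\mathcal{R}_n(k,l)$ is applied to a uniformly random permutation of $\{1,2,\dots,n\}$. Then $$E_n(k,l)=\frac{n+1}{2}\cdot\left(\frac{l}{k+1}+\frac{\binom{n-l}{k-l}}{\binom{n}{k}}\right).$$
   Context: The stopping rule $\mathcal{R}_n(k,l)$ (for positive integers $l\le k\le n-1$) selects an element $s$ of a permutation $a_1,a_2,\dots,a_n$ of $\{1,2,\dots,n\}$ as follows. Let $t$ be the $l$-th lowest value among $a_1,\dots,a_k$, and let $I=\{i\in\{1,\dots,n-k\} : a_{k+i}<t\}$. Let $j=\min I$ if $I\ne\emptyset$ and $j=n-k$ if $I=\emptyset$. The rule selects $s=a_{k+j}$. All $n!$ permutations are equally likely. (The value $s$ is the absolute rank of the selected candidate; rank $1$ is best.) *)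

theory Defs
  imports "HOL-Probability.Probability" "HOL-Combinatorics.Permutations"
begin

text \<open>
  A permutation \<open>a\<^sub>1, \<dots>, a\<^sub>n\<close> of \<open>{1, \<dots>, n}\<close> is a function \<open>a\<close> with \<open>a permutes {1..n}\<close>.
  The list operator \<open>!\<close> counts from 0, so the \<open>l\<close>-th lowest value, counting from 1, sits at
  position \<open>l - 1\<close>.
\<close>

definition threshold :: "nat \<Rightarrow> nat \<Rightarrow> (nat \<Rightarrow> nat) \<Rightarrow> nat" where
  "threshold k l a = sorted_list_of_set (a ` {1..k}) ! (l - 1)"

definition improving :: "nat \<Rightarrow> nat \<Rightarrow> nat \<Rightarrow> (nat \<Rightarrow> nat) \<Rightarrow> nat set" where
  "improving n k l a = {i \<in> {1..n - k}. a (k + i) < threshold k l a}"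

definition stopping_index :: "nat \<Rightarrow> nat \<Rightarrow> nat \<Rightarrow> (nat \<Rightarrow> nat) \<Rightarrow> nat" where
  "stopping_index n k l a =
     (if improving n k l a = {} then n - k else Min (improving n k l a))"

definition selected :: "nat \<Rightarrow> nat \<Rightarrow> nat \<Rightarrow> (nat \<Rightarrow> nat) \<Rightarrow> nat" where
  "selected n k l a = a (k + stopping_index n k l a)"

definition expected_rank :: "nat \<Rightarrow> nat \<Rightarrow> nat \<Rightarrow> real" where
  "expected_rank n k l =
     measure_pmf.expectation (pmf_of_set {a. a permutes {1..n}}) (\<lambda>a. real (selected n k l a))"

end

theory Submission
  imports Defs
begin

text \<open>
  Let \<open>t\<close> be the threshold and \<open>s\<close> the selected value. If some later value lies below \<open>t\<close>, reflect
  the values \<open>1, \<dots>, t - 1\<close>; otherwise reflect the values \<open>t + 1, \<dots>, n\<close>. This is an involution on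
  permutations that keeps \<open>t\<close> and the stopping time, and \<open>s\<close> plus its mirror image is \<open>t\<close> in the first
  case and \<open>t + n + 1\<close> in the second. Hence \<open>2 E(s) = E(t) + (n + 1) p\<close>, where \<open>p\<close> is the probability
  of the second case, in which \<open>1, \<dots>, l\<close> all occur among the first \<open>k\<close> entries.
  Since \<open>t\<close> is \<open>l\<close> plus the number of later values below \<open>t\<close>, and each of the \<open>n - k\<close> later values is
  below \<open>t\<close> with probability \<open>l / (k + 1)\<close>, we have \<open>E(t) = l (n + 1) / (k + 1)\<close>.
\<close>

section \<open>Counting permutations by exchangeability\<close>

text \<open>All positions in \<open>S\<close> are exchangeable, and in every permutation exactly \<open>l\<close> of them have relative
  rank below \<open>l\<close>; double counting gives the result.\<close>

lemma permutes_less_card_count: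
  fixes n :: nat
  assumes S: "S \<subseteq> {1..n}" and j: "j \<in> S" and l: "l \<le> card S"
  shows "card S * card {a. a permutes {1..n} \<and> card {i \<in> S. a i < a j} < l} = l * fact n"
proof -
  let ?P = "{a. a permutes {1..n}}"
  let ?r = "\<lambda>a m. card {i \<in> S. a i < a m}"
  have finS: "finite S" using S finite_subset by blast
  have finP: "finite ?P" by (simp add: finite_permutations)
  have exch: "card {a \<in> ?P. ?r a m < l} = card {a \<in> ?P. ?r a j < l}" if m: "m \<in> S" for m
  proof -
    let ?t = "Transposition.transpose m j"
    have t: "?t permutes S" using m j by (simp add: permutes_swap_id)
    then have tn: "?t permutes {1..n}" using S by (rule permutes_subset)
    \<comment> \<open>Swapping the positions \<open>m\<close> and \<open>j\<close> maps
      \<open>S\<close> to itself and moves the entry at \<open>m\<close> to \<open>j\<close>, so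
      relative ranks within \<open>S\<close> are carried along.\<close>
    have r: "?r (a \<circ> ?t) j = ?r a m" for a
    proof -
      have "{i \<in> S. a i < a m} = ?t ` {i \<in> S. (a \<circ> ?t) i < (a \<circ> ?t) j}"
      proof (intro set_eqI iffI)
        fix i assume "i \<in> {i \<in> S. a i < a m}"
        then have "?t i \<in> {i \<in> S. (a \<circ> ?t) i < (a \<circ> ?t) j}"
          using permutes_in_image[OF t] by simp
        then have "?t (?t i) \<in> ?t ` {i \<in> S. (a \<circ> ?t) i < (a \<circ> ?t) j}" by (rule imageI)
        then show "i \<in> ?t ` {i \<in> S. (a \<circ> ?t) i < (a \<circ> ?t) j}" by simp
      next
        fix i assume "i \<in> ?t ` {i \<in> S. (a \<circ> ?t) i < (a \<circ> ?t) j}"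
        then show "i \<in> {i \<in> S. a i < a m}"
          using permutes_in_image[OF t] by auto
      qed
      moreover have "card (?t ` {i \<in> S. (a \<circ> ?t) i < (a \<circ> ?t) j}) = ?r (a \<circ> ?t) j"
        using permutes_inj_on[OF t] by (rule card_image)
      ultimately show ?thesis by (simp only:)
    qed
    have "bij_betw (\<lambda>a. a \<circ> ?t) {a \<in> ?P. ?r a m < l} {a \<in> ?P. ?r a j < l}"
    proof (rule bij_betwI[where g = "\<lambda>a. a \<circ> ?t"])
      show "(\<lambda>a. a \<circ> ?t) \<in> {a \<in> ?P. ?r a m < l} \<rightarrow> {a \<in> ?P. ?r a j < l}"
        by (auto simp only: Pi_iff mem_Collect_eq r intro: permutes_compose[OF tn])
      have r': "?r (a \<circ> ?t) m = ?r a j" for a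
        using r[of "a \<circ> ?t"] by (simp add: comp_assoc)
      then show "(\<lambda>a. a \<circ> ?t) \<in> {a \<in> ?P. ?r a j < l} \<rightarrow> {a \<in> ?P. ?r a m < l}"
        by (auto simp only: Pi_iff mem_Collect_eq r' intro: permutes_compose[OF tn])
    qed (auto simp: comp_assoc)
    then show ?thesis by (rule bij_betw_same_card)
  qed
  have rank: "card {m \<in> S. ?r a m < l} = l" if a: "a \<in> ?P" for a
  proof -
    have inj: "inj a" using a permutes_inj by blast
    have mono: "?r a x < ?r a y" if "x \<in> S" "a x < a y" for x y
      by (rule psubset_card_mono) (use that finS in auto)
    have injr: "inj_on (?r a) S"
    proof (rule inj_onI)
      fix x y assume xy: "x \<in> S" "y \<in> S" "?r a x = ?r a y"
      then have "a x = a y" using mono[of x y] mono[of y x] by (metis nat_neq_iff)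
      then show "x = y" using inj by (simp add: inj_eq)
    qed
    \<comment> \<open>No position counts itself, so every rank is below \<open>card S\<close>. By
      injectivity all of these ranks occur, hence exactly \<open>l\<close> of them are below
      \<open>l\<close>.\<close>
    have "?r a ` S \<subseteq> {..<card S}"
      by (auto intro!: psubset_card_mono finS)
    then have im: "?r a ` S = {..<card S}"
      by (rule card_subset_eq[rotated]) (simp_all add: card_image injr)
    have "?r a ` {m \<in> S. ?r a m < l} = {x \<in> ?r a ` S. x < l}" by auto
    also have "\<dots> = {..<l}" unfolding im using l by auto
    finally have "?r a ` {m \<in> S. ?r a m < l} = {..<l}" .
    moreover have "inj_on (?r a) {m \<in> S. ?r a m < l}"
      using injr by (rule inj_on_subset) auto
    ultimately show ?thesis using card_image by fastforce
  qed
  have "(\<Sum>a\<in>?P. card {m \<in> S. ?r a m < l}) = card {a \<in> ?P. ?r a j < l} * card S"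
    by (rule sum_multicount) (use finP finS exch in auto)
  moreover have "(\<Sum>a\<in>?P. card {m \<in> S. ?r a m < l}) = l * fact n"
    using rank by (simp add: card_permutations)
  ultimately show ?thesis by (simp add: mult.commute)
qed

text \<open>If \<open>N(l)\<close> is the number of these permutations, then \<open>(n - l) N(l + 1) = (k - l) N(l)\<close>: the values
  above \<open>l\<close> are exchangeable, and exactly \<open>k - l\<close> of them occur among the first \<open>k\<close> entries.\<close>

lemma permutes_initial_subset_count:
  fixes n k l :: nat
  assumes "l \<le> k" "k \<le> n"
  shows "card {a. a permutes {1..n} \<and> {1..l} \<subseteq> a ` {1..k}} * (n choose k)
           = fact n * ((n - l) choose (k - l))"
  using assms(1)
proof (induction l)
  case 0
  then show ?case by (simp add: card_permutations)
next
  case (Suc l)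
  let ?N = "\<lambda>l. {a. a permutes {1..n} \<and> {1..l} \<subseteq> a ` {1..k}}"
  let ?T = "{Suc l..n}"
  have l: "l < k" using Suc.prems by simp
  have fin: "finite (?N l)"
    by (rule finite_subset[OF _ finite_permutations[of "{1..n}"]]) auto
  have one: "card {a \<in> ?N l. v \<in> a ` {1..k}} = card (?N (Suc l))" if v: "v \<in> ?T" for v
  proof -
    \<comment> \<open>The swap now acts on values, by composition on the left. Both \<open>v\<close>
      and \<open>Suc l\<close> exceed \<open>l\<close>, so the condition on \<open>{1..l}\<close> is
      preserved.\<close>
    let ?t = "Transposition.transpose v (Suc l)"
    have tn: "?t permutes {1..n}" using v l assms by (auto intro!: permutes_swap_id)
    have fixed: "?t x = x" if "x \<in> {1..l}" for x using that v by (auto simp: Transposition.transpose_def)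
    have sub: "{1..l} \<subseteq> (?t \<circ> a) ` {1..k}" if "{1..l} \<subseteq> a ` {1..k}" for a
    proof
      fix x assume x: "x \<in> {1..l}"
      with that obtain i where "i \<in> {1..k}" "x = a i" by blast
      then show "x \<in> (?t \<circ> a) ` {1..k}" using fixed[OF x] by force
    qed
    have ivl: "{1..Suc l} = insert (Suc l) {1..l}" by auto
    have "bij_betw (\<lambda>a. ?t \<circ> a) {a \<in> ?N l. v \<in> a ` {1..k}} (?N (Suc l))"
    proof (rule bij_betwI[where g = "\<lambda>a. ?t \<circ> a"])
      show "(\<lambda>a. ?t \<circ> a) \<in> {a \<in> ?N l. v \<in> a ` {1..k}} \<rightarrow> ?N (Suc l)"
      proof
        fix a assume a: "a \<in> {a \<in> ?N l. v \<in> a ` {1..k}}"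
        then obtain i where "i \<in> {1..k}" "v = a i" by blast
        then have "Suc l \<in> (?t \<circ> a) ` {1..k}" by force
        then show "?t \<circ> a \<in> ?N (Suc l)"
          unfolding ivl using a sub[of a] tn by (simp add: permutes_compose del: comp_apply)
      qed
      show "(\<lambda>a. ?t \<circ> a) \<in> ?N (Suc l) \<rightarrow> {a \<in> ?N l. v \<in> a ` {1..k}}"
      proof
        fix a assume a: "a \<in> ?N (Suc l)"
        then have a': "{1..l} \<subseteq> a ` {1..k}" "Suc l \<in> a ` {1..k}" unfolding ivl by auto
        then obtain i where "i \<in> {1..k}" "Suc l = a i" by blast
        then have "v \<in> (?t \<circ> a) ` {1..k}" by (force simp flip: \<open>Suc l = a i\<close>)
        then show "?t \<circ> a \<in> {a \<in> ?N l. v \<in> a ` {1..k}}"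
          using a a' sub[of a] tn by (simp add: permutes_compose del: comp_apply)
      qed
    qed (auto simp flip: comp_assoc)
    then show ?thesis by (rule bij_betw_same_card)
  qed
  have two: "card {v \<in> ?T. v \<in> a ` {1..k}} = k - l" if a: "a \<in> ?N l" for a
  proof -
    have perm: "a permutes {1..n}" using a by simp
    have "a ` {1..k} \<subseteq> {1..n}"
      using permutes_image[OF perm] image_mono[of "{1..k}" "{1..n}" a] assms(2) by auto
    then have "{v \<in> ?T. v \<in> a ` {1..k}} = a ` {1..k} - {1..l}" by fastforce
    moreover have "card (a ` {1..k}) = k"
      using permutes_inj_on[OF perm] by (simp add: card_image)
    ultimately show ?thesis using a by (simp add: card_Diff_subset)
  qed
  have "(\<Sum>a\<in>?N l. card {v \<in> ?T. v \<in> a ` {1..k}}) = card (?N (Suc l)) * card ?T"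
    by (rule sum_multicount) (use fin one in auto)
  moreover have "(\<Sum>a\<in>?N l. card {v \<in> ?T. v \<in> a ` {1..k}}) = (\<Sum>a\<in>?N l. k - l)"
    using two by (intro sum.cong) auto
  ultimately have step: "card (?N (Suc l)) * (n - l) = (k - l) * card (?N l)" by simp
  have absorb: "(k - l) * ((n - l) choose (k - l)) = (n - l) * ((n - Suc l) choose (k - Suc l))"
    using binomial_absorption[of "k - Suc l" "n - l"] l by (simp add: Suc_diff_Suc)
  \<comment> \<open>The recursion for the counts and the absorption identity for binomials have the
    same factors; the extra factor \<open>n - l\<close> avoids division and is cancelled at the
    end.\<close>
  have "(n - l) * (card (?N (Suc l)) * (n choose k)) = (card (?N (Suc l)) * (n - l)) * (n choose k)"
    by (simp only: mult_ac)
  also have "\<dots> = (k - l) * (card (?N l) * (n choose k))" unfolding step by (simp only: mult_ac)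
  also have "card (?N l) * (n choose k) = fact n * ((n - l) choose (k - l))"
    using Suc.IH l by simp
  also have "(k - l) * \<dots> = fact n * ((k - l) * ((n - l) choose (k - l)))" by (simp only: mult_ac)
  also have "\<dots> = (n - l) * (fact n * ((n - Suc l) choose (k - Suc l)))"
    unfolding absorb by (simp only: mult_ac)
  finally have "(n - l) * (card (?N (Suc l)) * (n choose k))
      = (n - l) * (fact n * ((n - Suc l) choose (k - Suc l)))" .
  moreover have "n - l > 0" using l assms by simp
  ultimately show ?case by simp
qed

section \<open>Rank in a finite linear order\<close>

text \<open>Since the list is strictly increasing, the elements below the entry at index
  \<open>m\<close> are exactly the \<open>m\<close> earlier entries. This trades the list in
  \<open>threshold\<close> for a description by rank.\<close>

lemma nth_sorted_list_of_set:
  fixes A :: "'a :: linorder set"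
  assumes "finite A" "m < card A"
  shows "sorted_list_of_set A ! m \<in> A" "card {x \<in> A. x < sorted_list_of_set A ! m} = m"
proof -
  let ?xs = "sorted_list_of_set A"
  have len: "length ?xs = card A" and set: "set ?xs = A" and dist: "distinct ?xs"
    using assms by auto
  have str: "sorted_wrt (<) ?xs" by simp
  show "?xs ! m \<in> A" using assms len set nth_mem by metis
  have less: "?xs ! i < ?xs ! j \<longleftrightarrow> i < j" if "i < card A" "j < card A" for i j
    using sorted_wrt_nth_less[OF str, of i j] sorted_wrt_nth_less[OF str, of j i] that len
    by (metis less_asym' nat_neq_iff)
  have "{x \<in> A. x < ?xs ! m} = (!) ?xs ` {..<m}"
  proof (intro set_eqI iffI)
    fix x assume x: "x \<in> {x \<in> A. x < ?xs ! m}"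
    then obtain i where "i < card A" "x = ?xs ! i" by (metis (no_types, lifting) in_set_conv_nth len mem_Collect_eq set)
    then show "x \<in> (!) ?xs ` {..<m}" using x less[of i m] assms by auto
  next
    fix x assume "x \<in> (!) ?xs ` {..<m}"
    then obtain i where i: "i < m" "x = ?xs ! i" by auto
    then have "?xs ! i \<in> set ?xs" by (intro nth_mem) (use assms len in simp)
    then show "x \<in> {x \<in> A. x < ?xs ! m}" using i less[of i m] assms set by simp
  qed
  moreover have "inj_on ((!) ?xs) {..<m}" using dist assms len by (intro inj_on_nth) auto
  ultimately show "card {x \<in> A. x < ?xs ! m} = m" by (simp add: card_image)
qed

text \<open>Of two distinct elements, the larger has everything below the smaller one beneath it,
  and the smaller one too. Hence a threshold can be recognised by its rank.\<close>

lemma card_less_inject: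
  fixes s t :: "'a :: linorder"
  assumes "finite A" "s \<in> A" "t \<in> A" "card {x \<in> A. x < s} = card {x \<in> A. x < t}"
  shows "s = t"
proof -
  have less: "card {x \<in> A. x < s} < card {x \<in> A. x < t}" if "s \<in> A" "s < t" for s t
    by (rule psubset_card_mono) (use that assms(1) in auto)
  show ?thesis
    using less[of s t] less[of t s] assms(2-4) by (cases s t rule: linorder_cases) simp_all
qed

section \<open>Reflection of an interval of values\<close>

text \<open>If \<open>q < p\<close> this is the identity, which covers the empty ranges that arise
  when the threshold is \<open>1\<close> or \<open>n\<close>.\<close>

definition reflect :: "nat \<Rightarrow> nat \<Rightarrow> nat \<Rightarrow> nat" where
  "reflect p q v = (if p \<le> v \<and> v \<le> q then p + q - v else v)"

lemma reflect_reflect [simp]: "reflect p q (reflect p q v) = v"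
  by (auto simp: reflect_def)

lemma reflect_permutes:
  assumes "1 \<le> p" "q \<le> n"
  shows "reflect p q permutes {1..n}"
proof (rule bij_imp_permutes)
  show "bij_betw (reflect p q) {1..n} {1..n}"
    by (rule bij_betwI[where g = "reflect p q"]) (use assms in \<open>auto simp: reflect_def\<close>)
qed (use assms in \<open>auto simp: reflect_def\<close>)

section \<open>The rule on a fixed permutation\<close>

locale stopping_rule =
  fixes n k l :: nat
  assumes l_pos: "1 \<le> l" and l_le: "l \<le> k" and k_less: "k < n"
begin

abbreviation "perms \<equiv> {a. a permutes {1..n}}"

lemma finite_perms: "finite perms"
  by (simp add: finite_permutations)

context
  fixes a assumes perm: "a permutes {1..n}"
begin

lemma perm_eq_iff [simp]: "a i = a j \<longleftrightarrow> i = j"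
  using permutes_inj[OF perm] by (simp add: inj_eq)

lemma perm_range: "i \<in> {1..n} \<Longrightarrow> a i \<in> {1..n}"
  using permutes_in_image[OF perm] by blast

lemma card_first: "card (a ` {1..k}) = k"
  using permutes_inj_on[OF perm] by (simp add: card_image)

lemma threshold_in: "threshold k l a \<in> a ` {1..k}"
  and card_less_threshold: "card {x \<in> a ` {1..k}. x < threshold k l a} = l - 1"
  unfolding threshold_def
  using nth_sorted_list_of_set[of "a ` {1..k}" "l - 1"] card_first l_pos l_le by auto

lemma threshold_eqI:
  assumes "t \<in> a ` {1..k}" "card {x \<in> a ` {1..k}. x < t} = l - 1"
  shows "threshold k l a = t"
  by (rule card_less_inject[OF _ threshold_in assms(1)])
    (simp, simp only: card_less_threshold assms(2))

lemma threshold_range: "threshold k l a \<in> {1..n}"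
  using threshold_in perm_range k_less by auto

text \<open>A later value is below the \<open>l\<close>-th lowest of the first \<open>k\<close> iff
  fewer than \<open>l\<close> of those are below it. Inserting \<open>j\<close>, which never counts
  itself, gives the set of \<open>k + 1\<close> exchangeable positions needed for the count.\<close>

lemma less_threshold_iff:
  assumes "j \<in> {k<..n}"
  shows "a j < threshold k l a \<longleftrightarrow> card {i \<in> insert j {1..k}. a i < a j} < l"
proof -
  let ?A = "a ` {1..k}" and ?t = "threshold k l a"
  have "{x \<in> ?A. x < a j} = a ` {i \<in> insert j {1..k}. a i < a j}" by auto
  then have c: "card {i \<in> insert j {1..k}. a i < a j} = card {x \<in> ?A. x < a j}"
    using permutes_inj_on[OF perm] by (simp add: card_image)
  have ne: "a j \<noteq> ?t" using threshold_in assms by auto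
  show ?thesis
  proof (cases "a j < ?t")
    case True
    then have "card {x \<in> ?A. x < a j} \<le> card {x \<in> ?A. x < ?t}" by (intro card_mono) auto
    then show ?thesis using True c card_less_threshold l_pos by simp
  next
    case False
    \<comment> \<open>The threshold and the \<open>l - 1\<close> early values under it already make
      \<open>l\<close> early values below \<open>a j\<close>.\<close>
    then have "insert ?t {x \<in> ?A. x < ?t} \<subseteq> {x \<in> ?A. x < a j}"
      using ne threshold_in by auto
    from card_mono[OF _ this] show ?thesis using False c card_less_threshold l_pos by simp
  qed
qed

text \<open>The values from \<open>1\<close> to the threshold minus one split into the
  \<open>l - 1\<close> at early positions and those at later positions.\<close>

lemma threshold_eq: "threshold k l a = l + card {j \<in> {k<..n}. a j < threshold k l a}"
proof -
  let ?A = "a ` {1..k}" and ?t = "threshold k l a"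
  have im: "a ` {1..n} = {1..n}" using permutes_image[OF perm] .
  have "{1..<?t} = {x \<in> ?A. x < ?t} \<union> a ` {j \<in> {k<..n}. a j < ?t}"
  proof (intro set_eqI iffI)
    fix x assume x: "x \<in> {1..<?t}"
    then have "x \<in> {1..n}" using threshold_range by auto
    then obtain i where "i \<in> {1..n}" "x = a i" using im by blast
    then show "x \<in> {x \<in> ?A. x < ?t} \<union> a ` {j \<in> {k<..n}. a j < ?t}"
      using x by (cases "i \<le> k") auto
  next
    fix x assume "x \<in> {x \<in> ?A. x < ?t} \<union> a ` {j \<in> {k<..n}. a j < ?t}"
    then show "x \<in> {1..<?t}" using perm_range k_less by force
  qed
  moreover have "{x \<in> ?A. x < ?t} \<inter> a ` {j \<in> {k<..n}. a j < ?t} = {}" by auto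
  ultimately have "card {1..<?t} = (l - 1) + card (a ` {j \<in> {k<..n}. a j < ?t})"
    using card_less_threshold by (simp add: card_Un_disjoint)
  moreover have "card (a ` {j \<in> {k<..n}. a j < ?t}) = card {j \<in> {k<..n}. a j < ?t}"
    using permutes_inj_on[OF perm] by (rule card_image)
  moreover have "?t \<ge> 1" using threshold_range by simp
  ultimately show ?thesis using l_pos by simp
qed

lemma improving_empty_iff_later: "improving n k l a = {} \<longleftrightarrow> {j \<in> {k<..n}. a j < threshold k l a} = {}"
proof -
  have "{j \<in> {k<..n}. a j < threshold k l a} = (\<lambda>i. k + i) ` improving n k l a"
  proof (intro set_eqI iffI)
    fix j assume j: "j \<in> {j \<in> {k<..n}. a j < threshold k l a}"
    then have "j = k + (j - k)" "j - k \<in> improving n k l a" by (auto simp: improving_def)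
    then show "j \<in> (\<lambda>i. k + i) ` improving n k l a" by (rule image_eqI)
  qed (auto simp: improving_def)
  then show ?thesis by simp
qed

text \<open>By \<open>threshold_eq\<close>, no later value is below the threshold iff the threshold
  is \<open>l\<close>, its least possible value. This turns the failure of the rule to find an
  improvement into the event counted by \<open>permutes_initial_subset_count\<close>.\<close>

lemma improving_empty_iff: "improving n k l a = {} \<longleftrightarrow> {1..l} \<subseteq> a ` {1..k}"
proof
  let ?A = "a ` {1..k}" and ?t = "threshold k l a"
  assume "improving n k l a = {}"
  then have later: "{j \<in> {k<..n}. a j < ?t} = {}" using improving_empty_iff_later by simp
  have "?t = l + card {j \<in> {k<..n}. a j < ?t}" by (rule threshold_eq)
  also have "\<dots> = l" unfolding later by simp
  finally have t: "?t = l" .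
  show "{1..l} \<subseteq> ?A"
  proof
    fix x assume x: "x \<in> {1..l}"
    show "x \<in> ?A"
    proof (cases "x = l")
      case True then show ?thesis using t threshold_in by simp
    next
      case False
      have "x \<in> {1..n}" using x l_le k_less by auto
      then obtain i where i: "i \<in> {1..n}" "x = a i" using permutes_image[OF perm] by blast
      then have "i \<notin> {k<..n}" using later t x False by auto
      then show ?thesis using i by auto
    qed
  qed
next
  let ?A = "a ` {1..k}" and ?t = "threshold k l a"
  assume sub: "{1..l} \<subseteq> ?A"
  have "{x \<in> ?A. x < l} = {1..<l}" using sub perm_range k_less by force
  then have t: "?t = l" using sub l_pos by (intro threshold_eqI) auto
  then have "card {j \<in> {k<..n}. a j < ?t} = 0" using threshold_eq by linarith
  then show "improving n k l a = {}" using improving_empty_iff_later by simp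
qed

lemma stopping_index_improving:
  assumes "improving n k l a \<noteq> {}"
  shows "stopping_index n k l a \<in> improving n k l a"
proof -
  have "finite (improving n k l a)" by (simp add: improving_def)
  then show ?thesis using assms by (simp add: stopping_index_def)
qed

lemma stopping_index_range: "k + stopping_index n k l a \<in> {k<..n}"
proof (cases "improving n k l a = {}")
  case True
  \<comment> \<open>The default index \<open>n - k\<close> points to position \<open>n\<close>,
    which lies after \<open>k\<close>.\<close>
  then show ?thesis using k_less by (simp add: stopping_index_def)
next
  case False
  then have "stopping_index n k l a \<in> {1..n - k}"
    using stopping_index_improving by (simp add: improving_def)
  then show ?thesis using k_less by auto
qed

lemma selected_less:
  assumes "improving n k l a \<noteq> {}"
  shows "selected n k l a \<in> {1..<threshold k l a}"
  using stopping_index_improving[OF assms] stopping_index_range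
    perm_range[of "k + stopping_index n k l a"]
  by (simp add: selected_def improving_def)

lemma selected_greater:
  assumes "improving n k l a = {}"
  shows "selected n k l a \<in> {threshold k l a<..n}"
proof -
  let ?j = "k + stopping_index n k l a"
  have "a ?j \<noteq> threshold k l a" using threshold_in stopping_index_range by auto
  moreover have "\<not> a ?j < threshold k l a"
    using assms improving_empty_iff_later stopping_index_range by blast
  ultimately show ?thesis
    using perm_range[of ?j] stopping_index_range by (auto simp: selected_def)
qed

section \<open>The mirror involution\<close>

text \<open>Once the threshold is known, the rule only asks which later values are below it. A
  relabelling that fixes the threshold and preserves the side below it therefore changes no
  decision, only the selected value.\<close>

lemma relabel:
  assumes r: "r permutes {1..n}" and fixed: "r (threshold k l a) = threshold k l a"
    and less: "\<And>v. v \<in> {1..n} \<Longrightarrow> r v < threshold k l a \<longleftrightarrow> v < threshold k l a"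
  shows "threshold k l (r \<circ> a) = threshold k l a" (is ?th)
    and "improving n k l (r \<circ> a) = improving n k l a" (is ?im)
    and "selected n k l (r \<circ> a) = r (selected n k l a)"
proof -
  let ?A = "a ` {1..k}" and ?t = "threshold k l a"
  have rp: "r \<circ> a permutes {1..n}" using perm r by (rule permutes_compose)
  have A: "?A \<subseteq> {1..n}" using perm_range k_less by auto
  have less_A: "r v < ?t \<longleftrightarrow> v < ?t" if "v \<in> ?A" for v
    using less A that by blast
  have comp: "(r \<circ> a) ` {1..k} = r ` ?A" by (rule image_comp[symmetric])
  have "{x \<in> (r \<circ> a) ` {1..k}. x < ?t} = r ` {x \<in> ?A. x < ?t}"
    unfolding comp using less_A by blast
  then have c: "card {x \<in> (r \<circ> a) ` {1..k}. x < ?t} = l - 1"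
    using card_less_threshold permutes_inj_on[OF r] by (simp add: card_image)
  have mem: "?t \<in> (r \<circ> a) ` {1..k}"
    unfolding comp using imageI[OF threshold_in, of r] fixed by simp
  show th: ?th by (rule stopping_rule.threshold_eqI[OF stopping_rule_axioms rp mem c])
  show im: ?im using less perm_range by (auto simp: improving_def th)
  show "selected n k l (r \<circ> a) = r (selected n k l a)"
    by (simp add: selected_def stopping_index_def im)
qed

end

definition flip :: "(nat \<Rightarrow> nat) \<Rightarrow> nat \<Rightarrow> nat" where
  "flip a = (if improving n k l a = {} then reflect (threshold k l a + 1) n
             else reflect 1 (threshold k l a - 1)) \<circ> a"

lemma flip:
  assumes perm: "a permutes {1..n}"
  shows "flip a permutes {1..n}" "flip (flip a) = a"
    "selected n k l a + selected n k l (flip a)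
       = threshold k l a + (if improving n k l a = {} then n + 1 else 0)"
proof -
  let ?t = "threshold k l a"
  define r where "r = (if improving n k l a = {} then reflect (?t + 1) n else reflect 1 (?t - 1))"
  have t: "?t \<in> {1..n}" using threshold_range[OF perm] .
  have fl: "flip a = r \<circ> a" by (simp add: flip_def r_def)
  have "reflect (?t + 1) n permutes {1..n}" by (rule reflect_permutes) auto
  moreover have "reflect 1 (?t - 1) permutes {1..n}" by (rule reflect_permutes) (use t in auto)
  ultimately have rp: "r permutes {1..n}" unfolding r_def by presburger
  have "r ?t = ?t" using t by (auto simp: r_def reflect_def)
  moreover have "r v < ?t \<longleftrightarrow> v < ?t" if "v \<in> {1..n}" for v
    using t that by (auto simp: r_def reflect_def)
  ultimately have rel: "threshold k l (r \<circ> a) = ?t"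
      "improving n k l (r \<circ> a) = improving n k l a"
      "selected n k l (r \<circ> a) = r (selected n k l a)"
    using relabel[OF perm rp] by blast+
  show "flip a permutes {1..n}" unfolding fl using perm rp by (rule permutes_compose)
  \<comment> \<open>The flipped permutation has the same threshold and falls in the same case, so
    the second flip uses the same reflection \<open>r\<close>.\<close>
  have "flip (flip a) = r \<circ> (r \<circ> a)"
    unfolding fl flip_def[of "r \<circ> a"] rel by (simp only: r_def)
  then show "flip (flip a) = a" by (auto simp: fun_eq_iff r_def)
  show "selected n k l a + selected n k l (flip a)
       = ?t + (if improving n k l a = {} then n + 1 else 0)"
    unfolding fl rel(3)
  \<comment> \<open>The selected value lies in the reflected interval, so it and its image add up to
    the sum of the endpoints: \<open>(t + 1) + n\<close> without an improvement,
    \<open>1 + (t - 1)\<close> with one.\<close>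
  proof (cases "improving n k l a = {}")
    case True
    then show "selected n k l a + r (selected n k l a)
       = ?t + (if improving n k l a = {} then n + 1 else 0)"
      using selected_greater[OF perm] by (simp add: r_def reflect_def)
  next
    case False
    moreover from this have "selected n k l a \<in> {1..<?t}" by (rule selected_less[OF perm])
    ultimately show "selected n k l a + r (selected n k l a)
       = ?t + (if improving n k l a = {} then n + 1 else 0)"
      by (auto simp: r_def reflect_def)
  qed
qed

section \<open>Summation over all permutations\<close>

text \<open>Reindexing along the involution \<open>flip\<close> leaves the sum unchanged, so twice
  the sum pairs each selected value with its mirror image.\<close>

lemma sum_selected:
  "2 * (\<Sum>a\<in>perms. selected n k l a)
     = (\<Sum>a\<in>perms. threshold k l a) + (n + 1) * card {a \<in> perms. {1..l} \<subseteq> a ` {1..k}}"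
proof -
  have "(\<Sum>a\<in>perms. selected n k l (flip a)) = (\<Sum>a\<in>perms. selected n k l a)"
    by (rule sum.reindex_bij_witness[where i = flip and j = flip]) (use flip in auto)
  then have "2 * (\<Sum>a\<in>perms. selected n k l a)
      = (\<Sum>a\<in>perms. selected n k l a + selected n k l (flip a))"
    by (simp add: sum.distrib)
  also have "\<dots> = (\<Sum>a\<in>perms. threshold k l a + (if {1..l} \<subseteq> a ` {1..k} then n + 1 else 0))"
    using flip(3) improving_empty_iff by (intro sum.cong) auto
  also have "\<dots> = (\<Sum>a\<in>perms. threshold k l a) + (n + 1) * card {a \<in> perms. {1..l} \<subseteq> a ` {1..k}}"
    using finite_perms by (simp add: sum.distrib sum.inter_filter[symmetric])
  finally show ?thesis .
qed

text \<open>Sum \<open>threshold_eq\<close> over all permutations and exchange the order of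
  summation. The factor \<open>k + 1\<close> keeps the count for each later position a natural
  number identity.\<close>

lemma sum_threshold: "(k + 1) * (\<Sum>a\<in>perms. threshold k l a) = l * (n + 1) * fact n"
proof -
  let ?C = "\<lambda>j. card {a \<in> perms. a j < threshold k l a}"
  have count: "(k + 1) * ?C j = l * fact n" if j: "j \<in> {k<..n}" for j
  proof -
    let ?S = "insert j {1..k}"
    have "{a \<in> perms. a j < threshold k l a}
        = {a. a permutes {1..n} \<and> card {i \<in> ?S. a i < a j} < l}"
      using less_threshold_iff j by blast
    moreover have "card ?S = k + 1" using j by simp
    ultimately show ?thesis
      using permutes_less_card_count[of ?S n j l] j l_le by auto
  qed
  have "(\<Sum>a\<in>perms. threshold k l a)
      = (\<Sum>a\<in>perms. l + card {j \<in> {k<..n}. a j < threshold k l a})"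
    by (rule sum.cong[OF refl], rule threshold_eq) simp
  also have "\<dots> = l * fact n + (\<Sum>a\<in>perms. card {j \<in> {k<..n}. a j < threshold k l a})"
    by (simp add: sum.distrib card_permutations)
  also have "(\<Sum>a\<in>perms. card {j \<in> {k<..n}. a j < threshold k l a}) = (\<Sum>j\<in>{k<..n}. ?C j)"
    by (rule sum_multicount_gen) (use finite_perms in auto)
  finally have "(k + 1) * (\<Sum>a\<in>perms. threshold k l a)
      = (k + 1) * (l * fact n) + (\<Sum>j\<in>{k<..n}. (k + 1) * ?C j)"
    by (simp only: distrib_left sum_distrib_left)
  also have "\<dots> = (k + 1) * (l * fact n) + (n - k) * (l * fact n)"
    using count by simp
  \<comment> \<open>In units of \<open>l * fact n\<close>, the constant \<open>l\<close> contributes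
    \<open>k + 1\<close> and each of the \<open>n - k\<close> later positions contributes
    one.\<close>
  also have "\<dots> = (k + 1 + (n - k)) * (l * fact n)" by (simp only: distrib_right)
  also have "k + 1 + (n - k) = n + 1" using k_less by simp
  finally show ?thesis by (simp only: mult_ac)
qed

lemma expected_rank_eq:
  "expected_rank n k l =
    (real n + 1) / 2 *
      (real l / (real k + 1) + real ((n - l) choose (k - l)) / real (n choose k))"
proof -
  let ?N = "card {a \<in> perms. {1..l} \<subseteq> a ` {1..k}}"
  let ?T = "\<Sum>a\<in>perms. threshold k l a"
  have "id permutes {1..n}" by (rule permutes_id)
  then have ne: "perms \<noteq> {}" by blast
  have "expected_rank n k l = real (\<Sum>a\<in>perms. selected n k l a) / fact n"
    unfolding expected_rank_def integral_pmf_of_set[OF ne finite_perms]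
    by (simp add: card_permutations)
  also have "real (\<Sum>a\<in>perms. selected n k l a) = (real ?T + (real n + 1) * real ?N) / 2"
    using arg_cong[OF sum_selected, of real] by (simp add: algebra_simps)
  also have "real ?T = real l * (real n + 1) * fact n / (real k + 1)"
  proof -
    have "(real k + 1) * real ?T = real l * (real n + 1) * fact n"
      using arg_cong[OF sum_threshold, of real] by (simp only: of_nat_mult of_nat_add of_nat_1 of_nat_fact)
    then show ?thesis by (simp add: field_simps)
  qed
  also have "real ?N = fact n * real ((n - l) choose (k - l)) / real (n choose k)"
  proof -
    have "real ?N * real (n choose k) = fact n * real ((n - l) choose (k - l))"
      using arg_cong[OF permutes_initial_subset_count[of l k n], of real] l_le k_less
      by simp
    moreover have "real (n choose k) \<noteq> 0" using k_less by simp
    ultimately show ?thesis by (simp add: field_simps)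
  qed
  finally have "expected_rank n k l = (real l * (real n + 1) * fact n / (real k + 1)
      + (real n + 1) * (fact n * real ((n - l) choose (k - l)) / real (n choose k))) / 2 / fact n" .
  also have "\<dots> = ((real n + 1) * (real l / (real k + 1)
      + real ((n - l) choose (k - l)) / real (n choose k))) * fact n / 2 / fact n"
    by (simp only: divide_inverse distrib_left distrib_right mult_ac)
  also have "\<dots> = (real n + 1) * (real l / (real k + 1)
      + real ((n - l) choose (k - l)) / real (n choose k)) / 2"
    by (simp only: divide_divide_eq_left mult_divide_mult_cancel_right fact_nonzero not_False_eq_True)
  finally show ?thesis by (simp only: times_divide_eq_left)
qed

end

theorem theorem1:
  fixes n k l :: nat
  assumes "1 \<le> l" and "l \<le> k" and "k \<le> n - 1" and "1 \<le> n"
  shows "expected_rank n k l =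
    (real n + 1) / 2 *
      (real l / (real k + 1) + real ((n - l) choose (k - l)) / real (n choose k))"
proof -
  interpret stopping_rule n k l
    by unfold_locales (use assms in auto)
  show ?thesis by (rule expected_rank_eq)
qed

end
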